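(* Consider the following three discrete update maps $(\mathbf\Xi^n,\mathbf V^n,\mathbf e^n,\mathbf b^n)\mapsto(\mathbf\Xi^{n+1},\mathbf V^{n+1},\mathbf e^{n+1},\mathbf b^{n+1})$ with time step $\Delta t$, where $t^{n+1}=t^n+\Delta t$. (S1) With $\mathbf\Xi(\tau)=\frac{(t^{n+1}-\tau)\mathbf\Xi^n+(\tau-t^n)\mathbf\Xi^{n+1}}{\Delta t}$, the new state satisfies $$\frac{\mathbf\Xi^{n+1}-\mathbf\Xi^n}{\Delta t}=\frac{\mathbb N(\mathbf\Xi^n)^\top+\mathbb N(\mathbf\Xi^{n+1})^\top}2\,\frac{\mathbf V^{n+1}+\mathbf V^n}2,$$ $$\frac{\mathbf V^{n+1}-\mathbf V^n}{\Delta t}=\mathbb M_m^{-1}\mathbb M_q\frac{\mathbb N(\mathbf\Xi^n)+\mathbb N(\mathbf\Xi^{n+1})}2\,\frac1{\Delta t}\int_{t^n}^{t^{n+1}}\mathbb L^1(\mathbf\Xi(\tau))\,d\tau\,\frac{\mathbf e^{n+1}+\mathbf e^n}2,$$ $$\frac{\tilde{\mathsf M}_1\mathbf e^{n+1}-\tilde{\mathsf M}_1\mathbf e^n}{\Delta t}=-\frac1{\Delta t}\int_{t^n}^{t^{n+1}}\mathbb L^1(\mathbf\Xi(\tau))^\top d\tau\,\frac{\mathbb N(\mathbf\Xi^n)^\top+\mathbb N(\mathbf\Xi^{n+1})^\top}2\,\mathbb M_q\frac{\mathbf V^{n+1}+\mathbf V^n}2,\qquad\mathbf b^{n+1}=\mathbf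 b^n.$$ (S2) $\mathbf\Xi,\mathbf e,\mathbf b$ unchanged and, with $\mathbb N=\mathbb N(\mathbf\Xi^n)$, $\tilde{\mathbb B}=\tilde{\mathbb B}(\mathbf\Xi^n,\mathbf b^n)$, $$\Big(\mathbb I-\tfrac{\Delta t}2\mathbb M_m^{-1}\mathbb M_q\mathbb N\tilde{\mathbb B}\mathbb N^\top\Big)\mathbf V^{n+1}=\Big(\mathbb I+\tfrac{\Delta t}2\mathbb M_m^{-1}\mathbb M_q\mathbb N\tilde{\mathbb B}\mathbb N^\top\Big)\mathbf V^n.$$ (S3) $\mathbf\Xi,\mathbf V$ unchanged and, with $S=\tilde{\mathsf M}_1+\frac{\Delta t^2}4\mathsf C^\top\tilde{\mathsf M}_2\mathsf C$, $$\mathbf e^{n+1}=S^{-1}\Big(\big(\tilde{\mathsf M}_1-\tfrac{\Delta t^2}4\mathsf C^\top\tilde{\mathsf M}_2\mathsf C\big)\mathbf e^n+\Delta t\,\mathsf C^\top\tilde{\mathsf M}_2\mathbf b^n\Big),\qquad\mathbf b^{n+1}=\mathbf b^n-\tfrac{\Delta t}2\mathsf C(\mathbf e^n+\mathbf e^{n+1}).$$ Then for the splitting scheme that advances the state by successive application of (S1), (S2), (S3), the discrete energy $$\tilde{\mathcal H}_h=\tfrac12\mathbf V^\top\mathbb M_m\mathbf V+\tfrac12\mathbf e^\top\tilde{\mathsf M}_1\mathbf e+\tfrac12\mathbf b^\top\tilde{\mathsf M}_2\mathbf b$$ is conserved.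
   Context: Geometry: $\tilde\Omega=[0,1]^3$ and $F:\tilde\Omega\to\Omega\subset\mathbb R^3$ is a smooth bijection with $J_F(\xi)=\det DF(\xi)\neq0$ for all $\xi$. Put $N(\xi)=DF(\xi)^{-\top}$, $G_n=N^\top N$, $G_t=DF^\top DF$. Discrete de Rham sequence on $\tilde\Omega$: there are linearly independent families of basis functions, collected in rows: $\tilde\Lambda^0(\xi)\in\mathbb R^{1\times N_0}$, $\tilde{\mathbf\Lambda}^1(\xi)\in\mathbb R^{3\times3N_1}$, $\tilde{\mathbf\Lambda}^2(\xi)\in\mathbb R^{3\times3N_2}$, $\tilde\Lambda^3(\xi)\in\mathbb R^{1\times N_3}$, and constant matrices $\mathsf G\in\mathbb R^{3N_1\times N_0}$, $\mathsf C\in\mathbb R^{3N_2\times3N_1}$, $\mathsf D\in\mathbb R^{N_3\times3N_2}$ such that (columnwise) $\nabla\tilde\Lambda^0=\tilde{\mathbf\Lambda}^1\mathsf G$, $\nabla\times\tilde{\mathbf\Lambda}^1=\tilde{\mathbf\Lambda}^2\mathsf C$, $\nabla\cdot\tilde{\mathbf\Lambda}^2=\tilde\Lambda^3\mathsf D$, with $\mathsf D\mathsf C=0$, $\mathsf C\mathsf G=0$. Mass matrices: $\tilde{\mathsf M}_1=\int_{\tilde\Omega}(\tilde{\mathbf\Lambda}^1)^\top G_n\tilde{\mathbf\Lambda}^1|J_F|\,d\xi$, $\tilde{\mathsf M}_2=\int_{\tilde\Omega}(\tilde{\mathbf\Lambda}^2)^\top G_t\tilde{\mathbf\Lambda}^2\frac1{|J_F|}\,d\xi$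 (symmetric positive definite). Particles: $N_p$ particles with logical positions $\xi_p\in\tilde\Omega$, velocities $v_p\in\mathbb R^3$, constant weights $\omega_p>0$, masses $m_p>0$, charges $q_p$. $\mathbf\Xi=(\xi_1,\dots,\xi_{N_p})$, $\mathbf V=(v_1,\dots,v_{N_p})$; $\mathbf e\in\mathbb R^{3N_1}$, $\mathbf b\in\mathbb R^{3N_2}$ are the field coefficients. $\mathbb M_m=\mathrm{diag}(\omega_pm_p)\otimes\mathbb I_3$, $\mathbb M_q=\mathrm{diag}(\omega_pq_p)\otimes\mathbb I_3$; $\mathbb N(\mathbf\Xi)$ is block diagonal with blocks $N(\xi_p)$; $\mathbb L^1(\mathbf\Xi)\in\mathbb R^{3N_p\times3N_1}$ is obtained by stacking the blocks $\tilde{\mathbf\Lambda}^1(\xi_p)$; $\tilde{\mathbb B}(\mathbf\Xi,\mathbf b)$ is block diagonal with $p$-th block the (antisymmetric) matrix of $w\mapsto w\times\tilde{\mathbf\Lambda}^2(\xi_p)\mathbf b$. The updates may be composed in any order, each substep possibly with its own step size; it is assumed that the implicit update (S1) has a solution with positions in $\tilde\Omega$ and that the scheme uses such a solution. *)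

theory Defs
  imports "HOL-Analysis.Analysis"
begin

abbreviation cube :: "(real^3) set"
  where "cube \<equiv> cbox 0 1"

section \<open>The coordinate map\<close>

text \<open>Smoothness is meant up to the boundary: derivatives are taken within \<open>S\<close>, which
  determines them uniquely when \<open>S\<close> is a nondegenerate closed box.\<close>

primrec C_k_on :: "nat \<Rightarrow> 'a::real_normed_vector set \<Rightarrow> ('a \<Rightarrow> 'b::real_normed_vector) \<Rightarrow> bool" where
  "C_k_on 0 S = (\<lambda>f. continuous_on S f)"
| "C_k_on (Suc k) S = (\<lambda>f. \<exists>f'. (\<forall>x\<in>S. (f has_derivative f' x) (at x within S)) \<and>
      (\<forall>v. C_k_on k S (\<lambda>x. f' x v)))"

definition smooth_on :: "'a::real_normed_vector set \<Rightarrow> ('a \<Rightarrow> 'b::real_normed_vector) \<Rightarrow> bool"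
  where "smooth_on S f \<longleftrightarrow> (\<forall>k. C_k_on k S f)"

definition DF :: "(real^3 \<Rightarrow> real^3) \<Rightarrow> real^3 \<Rightarrow> real^3^3"
  where "DF F \<xi> = jacobian F (at \<xi> within cube)"

definition J :: "(real^3 \<Rightarrow> real^3) \<Rightarrow> real^3 \<Rightarrow> real"
  where "J F \<xi> = det (DF F \<xi>)"

definition N :: "(real^3 \<Rightarrow> real^3) \<Rightarrow> real^3 \<Rightarrow> real^3^3"
  where "N F \<xi> = transpose (matrix_inv (DF F \<xi>))"

definition G\<^sub>n :: "(real^3 \<Rightarrow> real^3) \<Rightarrow> real^3 \<Rightarrow> real^3^3"
  where "G\<^sub>n F \<xi> = transpose (N F \<xi>) ** N F \<xi>"

definition G\<^sub>t :: "(real^3 \<Rightarrow> real^3) \<Rightarrow> real^3 \<Rightarrow> real^3^3"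
  where "G\<^sub>t F \<xi> = transpose (DF F \<xi>) ** DF F \<xi>"

section \<open>Discrete fields\<close>

definition has_curl :: "(real^3 \<Rightarrow> real^3) \<Rightarrow> real^3 \<Rightarrow> real^3 \<Rightarrow> bool"
  where "has_curl u c \<xi> \<longleftrightarrow> u differentiable (at \<xi>) \<and>
    (let A = jacobian u (at \<xi>) in
      c = vector [A $ 3 $ 2 - A $ 2 $ 3, A $ 1 $ 3 - A $ 3 $ 1, A $ 2 $ 1 - A $ 1 $ 2])"

definition has_div :: "(real^3 \<Rightarrow> real^3) \<Rightarrow> real \<Rightarrow> real^3 \<Rightarrow> bool"
  where "has_div u d \<xi> \<longleftrightarrow> u differentiable (at \<xi>) \<and> d = trace (jacobian u (at \<xi>))"

text \<open>Finite element and spline bases are in general only piecewise smooth and are identified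
  when they agree almost everywhere, so linear independence and the de Rham identities are
  understood almost everywhere on the cube. For continuous families the first of these
  is ordinary linear independence. In all of this the columns of \<open>\<Lambda>\<close> are the basis
  functions.\<close>

definition independent_family :: "(real^3 \<Rightarrow> real^'k^'d) \<Rightarrow> bool"
  where "independent_family \<Lambda> \<longleftrightarrow>
    (\<forall>c. (AE \<xi> in lebesgue_on cube. \<Lambda> \<xi> *v c = 0) \<longrightarrow> c = 0)"

definition square_integrable_family :: "(real^3 \<Rightarrow> real^'k^'d) \<Rightarrow> bool"
  where "square_integrable_family \<Lambda> \<longleftrightarrow> \<Lambda> \<in> borel_measurable (lebesgue_on cube) \<and>
    integrable (lebesgue_on cube) (\<lambda>\<xi>. (norm (\<Lambda> \<xi>))\<^sup>2)"

definition discrete_de_rham ::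
  "(real^3 \<Rightarrow> real^'n0^1) \<Rightarrow> (real^3 \<Rightarrow> real^('n1::finite\<times>3)^3) \<Rightarrow>
   (real^3 \<Rightarrow> real^('n2::finite\<times>3)^3) \<Rightarrow> (real^3 \<Rightarrow> real^'n3^1) \<Rightarrow>
   real^'n0^('n1\<times>3) \<Rightarrow> real^('n1\<times>3)^('n2\<times>3) \<Rightarrow> real^('n2\<times>3)^'n3 \<Rightarrow> bool"
  where "discrete_de_rham \<Lambda>0 \<Lambda>1 \<Lambda>2 \<Lambda>3 G C D \<longleftrightarrow>
    (AE \<xi> in lebesgue_on cube. \<forall>j. GDERIV (\<lambda>x. \<Lambda>0 x $ 1 $ j) \<xi> :> column j (\<Lambda>1 \<xi> ** G)) \<and>
    (AE \<xi> in lebesgue_on cube. \<forall>j. has_curl (\<lambda>x. column j (\<Lambda>1 x)) (column j (\<Lambda>2 \<xi> ** C)) \<xi>) \<and>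
    (AE \<xi> in lebesgue_on cube. \<forall>j. has_div (\<lambda>x. column j (\<Lambda>2 x)) ((\<Lambda>3 \<xi> ** D) $ 1 $ j) \<xi>) \<and>
    D ** C = 0 \<and> C ** G = 0"

definition mass1 :: "(real^3 \<Rightarrow> real^3) \<Rightarrow> (real^3 \<Rightarrow> real^'k^3) \<Rightarrow> real^'k^'k"
  where "mass1 F \<Lambda>1 = (LINT \<xi>|lebesgue_on cube.
    \<bar>J F \<xi>\<bar> *\<^sub>R (transpose (\<Lambda>1 \<xi>) ** G\<^sub>n F \<xi> ** \<Lambda>1 \<xi>))"

definition mass2 :: "(real^3 \<Rightarrow> real^3) \<Rightarrow> (real^3 \<Rightarrow> real^'k^3) \<Rightarrow> real^'k^'k"
  where "mass2 F \<Lambda>2 = (LINT \<xi>|lebesgue_on cube.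
    (1 / \<bar>J F \<xi>\<bar>) *\<^sub>R (transpose (\<Lambda>2 \<xi>) ** G\<^sub>t F \<xi> ** \<Lambda>2 \<xi>))"

section \<open>Particles\<close>

text \<open>\<open>X\<close> stands for the stacked positions \<open>\<Xi>\<close>. The entries of the stacked vectors
  \<open>X, V \<in> \<real>\<^bsup>3N\<^sub>p\<^esup>\<close> are indexed by pairs (particle, Cartesian component).\<close>

definition particle :: "real^('p::finite\<times>3) \<Rightarrow> 'p \<Rightarrow> real^3"
  where "particle X p = (\<chi> i. X $ (p, i))"

definition diag :: "('n \<Rightarrow> real) \<Rightarrow> real^'n^'n"
  where "diag d = (\<chi> i j. if i = j then d i else 0)"

definition kronecker :: "real^'b^'a \<Rightarrow> real^'d^'c \<Rightarrow> real^('b\<times>'d)^('a\<times>'c)"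
  where "kronecker A B = (\<chi> i j. A $ fst i $ fst j * B $ snd i $ snd j)"

definition block_diag :: "('p::finite \<Rightarrow> real^3^3) \<Rightarrow> real^('p\<times>3)^('p\<times>3)"
  where "block_diag A = (\<chi> i j. if fst i = fst j then A (fst i) $ snd i $ snd j else 0)"

definition MM\<^sub>m :: "('p::finite \<Rightarrow> real) \<Rightarrow> ('p \<Rightarrow> real) \<Rightarrow> real^('p\<times>3)^('p\<times>3)"
  where "MM\<^sub>m \<omega> m = kronecker (diag (\<lambda>p. \<omega> p * m p)) (mat 1)"

definition MM\<^sub>q :: "('p::finite \<Rightarrow> real) \<Rightarrow> ('p \<Rightarrow> real) \<Rightarrow> real^('p\<times>3)^('p\<times>3)"
  where "MM\<^sub>q \<omega> q = kronecker (diag (\<lambda>p. \<omega> p * q p)) (mat 1)"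

definition NN :: "(real^3 \<Rightarrow> real^3) \<Rightarrow> real^('p::finite\<times>3) \<Rightarrow> real^('p\<times>3)^('p\<times>3)"
  where "NN F X = block_diag (\<lambda>p. N F (particle X p))"

definition LL :: "(real^3 \<Rightarrow> real^'k^3) \<Rightarrow> real^('p::finite\<times>3) \<Rightarrow> real^'k^('p\<times>3)"
  where "LL \<Lambda>1 X = (\<chi> i. \<Lambda>1 (particle X (fst i)) $ snd i)"

definition BB :: "(real^3 \<Rightarrow> real^'k^3) \<Rightarrow> real^('p::finite\<times>3) \<Rightarrow> real^'k \<Rightarrow> real^('p\<times>3)^('p\<times>3)"
  where "BB \<Lambda>2 X b = block_diag (\<lambda>p. matrix (\<lambda>w. cross3 w (\<Lambda>2 (particle X p) *v b)))"

section \<open>The three substeps\<close>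

type_synonym ('p, 'n1, 'n2) state =
  "(real^('p\<times>3)) \<times> (real^('p\<times>3)) \<times> (real^('n1\<times>3)) \<times> (real^('n2\<times>3))"

definition line_path :: "real \<Rightarrow> real \<Rightarrow> 'a::real_vector \<Rightarrow> 'a \<Rightarrow> real \<Rightarrow> 'a"
  where "line_path t h X X' \<tau> = (1 / h) *\<^sub>R ((t + h - \<tau>) *\<^sub>R X + (\<tau> - t) *\<^sub>R X')"

text \<open>\<open>S1\<close> is implicit and hence a relation; \<open>t\<close> is the time before the substep and \<open>h\<close> its
  step size. The interval integrals are oriented, so that \<open>h < 0\<close> makes sense, too.\<close>

fun S1 :: "(real^3 \<Rightarrow> real^3) \<Rightarrow> (real^3 \<Rightarrow> real^('n1\<times>3)^3) \<Rightarrow>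
    ('p \<Rightarrow> real) \<Rightarrow> ('p \<Rightarrow> real) \<Rightarrow> ('p \<Rightarrow> real) \<Rightarrow> real \<Rightarrow> real \<Rightarrow>
    ('p::finite, 'n1::finite, 'n2::finite) state \<Rightarrow> ('p, 'n1, 'n2) state \<Rightarrow> bool" where
  "S1 F \<Lambda>1 \<omega> m q t h (X, V, e, b) (X', V', e', b') \<longleftrightarrow>
    (\<forall>p. particle X' p \<in> cube) \<and>
    interval_lebesgue_integrable lborel (ereal t) (ereal (t + h)) (\<lambda>\<tau>. LL \<Lambda>1 (line_path t h X X' \<tau>)) \<and>
    (1 / h) *\<^sub>R (X' - X) =
      ((1/2) *\<^sub>R (transpose (NN F X) + transpose (NN F X'))) *v ((1/2) *\<^sub>R (V' + V)) \<and>
    (1 / h) *\<^sub>R (V' - V) =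
      (matrix_inv (MM\<^sub>m \<omega> m) ** MM\<^sub>q \<omega> q ** ((1/2) *\<^sub>R (NN F X + NN F X')) **
       ((1 / h) *\<^sub>R (LBINT \<tau>=ereal t..ereal (t + h). LL \<Lambda>1 (line_path t h X X' \<tau>)))) *v
      ((1/2) *\<^sub>R (e' + e)) \<and>
    (1 / h) *\<^sub>R (mass1 F \<Lambda>1 *v e' - mass1 F \<Lambda>1 *v e) =
      - ((((1 / h) *\<^sub>R (LBINT \<tau>=ereal t..ereal (t + h). transpose (LL \<Lambda>1 (line_path t h X X' \<tau>)))) **
          ((1/2) *\<^sub>R (transpose (NN F X) + transpose (NN F X'))) ** MM\<^sub>q \<omega> q) *v
         ((1/2) *\<^sub>R (V' + V))) \<and>
    b' = b"

fun S2 :: "(real^3 \<Rightarrow> real^3) \<Rightarrow> (real^3 \<Rightarrow> real^('n2\<times>3)^3) \<Rightarrow>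
    ('p \<Rightarrow> real) \<Rightarrow> ('p \<Rightarrow> real) \<Rightarrow> ('p \<Rightarrow> real) \<Rightarrow> real \<Rightarrow>
    ('p::finite, 'n1::finite, 'n2::finite) state \<Rightarrow> ('p, 'n1, 'n2) state \<Rightarrow> bool" where
  "S2 F \<Lambda>2 \<omega> m q h (X, V, e, b) (X', V', e', b') \<longleftrightarrow>
    X' = X \<and> e' = e \<and> b' = b \<and>
    (let K = matrix_inv (MM\<^sub>m \<omega> m) ** MM\<^sub>q \<omega> q ** NN F X ** BB \<Lambda>2 X b ** transpose (NN F X)
     in (mat 1 - (h/2) *\<^sub>R K) *v V' = (mat 1 + (h/2) *\<^sub>R K) *v V)"

fun S3 :: "(real^3 \<Rightarrow> real^3) \<Rightarrow> (real^3 \<Rightarrow> real^('n1\<times>3)^3) \<Rightarrow> (real^3 \<Rightarrow> real^('n2\<times>3)^3) \<Rightarrow>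
    real^('n1\<times>3)^('n2\<times>3) \<Rightarrow> real \<Rightarrow>
    ('p::finite, 'n1::finite, 'n2::finite) state \<Rightarrow> ('p, 'n1, 'n2) state \<Rightarrow> bool" where
  "S3 F \<Lambda>1 \<Lambda>2 C h (X, V, e, b) (X', V', e', b') \<longleftrightarrow>
    X' = X \<and> V' = V \<and>
    (let M\<^sub>1 = mass1 F \<Lambda>1; M\<^sub>2 = mass2 F \<Lambda>2;
         S = M\<^sub>1 + (h\<^sup>2/4) *\<^sub>R (transpose C ** M\<^sub>2 ** C)
     in e' = matrix_inv S *v ((M\<^sub>1 - (h\<^sup>2/4) *\<^sub>R (transpose C ** M\<^sub>2 ** C)) *v e
                             + h *\<^sub>R ((transpose C ** M\<^sub>2) *v b))) \<and>
    b' = b - (h/2) *\<^sub>R (C *v (e + e'))"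

fun energy :: "(real^3 \<Rightarrow> real^3) \<Rightarrow> (real^3 \<Rightarrow> real^('n1\<times>3)^3) \<Rightarrow> (real^3 \<Rightarrow> real^('n2\<times>3)^3) \<Rightarrow>
    ('p \<Rightarrow> real) \<Rightarrow> ('p \<Rightarrow> real) \<Rightarrow> ('p::finite, 'n1::finite, 'n2::finite) state \<Rightarrow> real" where
  "energy F \<Lambda>1 \<Lambda>2 \<omega> m (X, V, e, b) =
    1/2 * (V \<bullet> (MM\<^sub>m \<omega> m *v V)) + 1/2 * (e \<bullet> (mass1 F \<Lambda>1 *v e)) + 1/2 * (b \<bullet> (mass2 F \<Lambda>2 *v b))"

text \<open>One substep of a splitting scheme: any of the three updates, with any nonzero step size.\<close>

definition substep where
  "substep F \<Lambda>1 \<Lambda>2 C \<omega> m q s s' \<longleftrightarrow> (\<exists>t h. h \<noteq> 0 \<and>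
    (S1 F \<Lambda>1 \<omega> m q t h s s' \<or> S2 F \<Lambda>2 \<omega> m q h s s' \<or> S3 F \<Lambda>1 \<Lambda>2 C h s s'))"

end

theory Submission
  imports Defs
begin

text \<open>
  Every substep is a midpoint rule for a skew-symmetric system, and this is why it keeps the energy.
  For a symmetric matrix \<open>M\<close> the quadratic form \<open>x \<bullet> M x\<close> changes by
  \<open>(x' + x) \<bullet> M (x' - x)\<close> when \<open>x\<close> moves to \<open>x'\<close> (\<open>symmetric_form_difference\<close>). Each update
  prescribes \<open>M (x' - x)\<close> as a coupling operator applied to a sum of old and new values, so that
  the change of energy is a bilinear expression in such sums that cancels.

  In \<open>S1\<close> the velocities are driven by \<open>1/2 P (e' + e)\<close> and the field by
  \<open>- 1/2 P\<^sup>T (V' + V)\<close> with the same matrix \<open>P\<close>, so that the kinetic energy gained is the field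
  energy lost. In \<open>S2\<close> the force on each particle is \<open>N\<close> applied to a cross product with
  \<open>N\<^sup>T V\<close> and does no work (\<open>magnetic_force_orthogonal\<close>). In \<open>S3\<close> the coupling of \<open>e\<close> and \<open>b\<close> is by \<open>C\<close> in one equation and by
  \<open>C\<^sup>T\<close> in the other; here the explicit formula with \<open>S\<^sup>-\<^sup>1\<close> first has to be turned back into
  the midpoint rule.

  This last step is where analysis enters: it requires \<open>S = M\<^sub>1 + h\<^sup>2/4 C\<^sup>T M\<^sub>2 C\<close> to be invertible.
  Both mass matrices are weighted Gram matrices, hence symmetric and positive semidefinite, and
  \<open>M\<^sub>1\<close> is positive definite (\<open>mass1_pos\<close>): the weight is continuous on the compact cube, hence
  bounded, which makes the integral converge for square integrable basis functions, and
  \<open>v \<bullet> M\<^sub>1 v = 0\<close> forces the field with coefficients \<open>v\<close> to vanish almost everywhere.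
\<close>

section \<open>Symmetric matrices and inverses\<close>

lemma symmetric_form_difference:
  fixes M :: "real^'n^'n"
  assumes "transpose M = M"
  shows "x' \<bullet> (M *v x') - x \<bullet> (M *v x) = (x' + x) \<bullet> (M *v (x' - x))"
proof -
  have "x' \<bullet> (M *v x) = x \<bullet> (M *v x')"
    by (metis assms dot_lmul_matrix inner_commute transpose_matrix_vector)
  then show ?thesis
    by (simp add: algebra_simps inner_simps)
qed

lemma inner_transpose_matrix:
  fixes A :: "real^'n^'m"
  shows "x \<bullet> (transpose A *v y) = (A *v x) \<bullet> y"
  by (metis dot_lmul_matrix inner_commute transpose_matrix_vector)

text \<open>The inverse \<open>matrix_inv\<close> is defined by choice; for a square matrix a trivial kernel already
  guarantees that there is an inverse to choose.\<close>

lemma matrix_inv_right_of_trivial_kernel: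
  fixes A :: "real^'n^'n"
  assumes "\<And>x. A *v x = 0 \<Longrightarrow> x = 0"
  shows "A ** matrix_inv A = mat 1"
proof -
  have "invertible A"
    using assms invertible_left_inverse matrix_left_invertible_ker by blast
  then show ?thesis
    unfolding invertible_def matrix_inv_def by (rule someI2_ex) blast
qed

lemma continuous_on_det:
  fixes A :: "'a::topological_space \<Rightarrow> real^'n^'n"
  assumes "\<And>i j. continuous_on S (\<lambda>x. A x $ i $ j)"
  shows "continuous_on S (\<lambda>x. det (A x))"
  unfolding det_def by (intro continuous_intros assms)

text \<open>Cramer's rule expresses the entries of the inverse as quotients of determinants, which are
  polynomials in the entries of the matrix.\<close>

lemma continuous_on_matrix_inv:
  fixes A :: "'a::topological_space \<Rightarrow> real^'n^'n"
  assumes "continuous_on S A" and "\<And>x. x \<in> S \<Longrightarrow> det (A x) \<noteq> 0"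
  shows "continuous_on S (\<lambda>x. matrix_inv (A x))"
proof -
  let ?R = "\<lambda>x k l. \<chi> i j. if j = k then axis l 1 $ i else A x $ i $ j"
  have "matrix_inv (A x) = (\<chi> k l. det (?R x k l) / det (A x))" if "x \<in> S" for x
  proof -
    have "A x ** matrix_inv (A x) = mat 1"
      using assms(2)[OF that] matrix_inv_right_of_trivial_kernel
      by (metis invertible_det_nz invertible_left_inverse matrix_left_invertible_ker)
    then have "A x *v (matrix_inv (A x) *v axis l 1) = axis l 1" for l
      by (simp add: matrix_vector_mul_assoc)
    then have *: "matrix_inv (A x) *v axis l 1 = (\<chi> k. det (?R x k l) / det (A x))" for l
      using cramer[OF assms(2)[OF that]] by blast
    have "matrix_inv (A x) $ k $ l = (matrix_inv (A x) *v axis l 1) $ k" for k l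
      by (simp add: matrix_vector_mult_basis column_def)
    with * show ?thesis
      by (simp add: vec_eq_iff)
  qed
  moreover have "continuous_on S (\<lambda>x. \<chi> k l. det (?R x k l) / det (A x))"
  proof (intro continuous_on_vec_lambda continuous_on_divide continuous_on_det)
    fix i j k l
    show "continuous_on S (\<lambda>x. ?R x k l $ i $ j)"
      by (cases "j = k") (auto intro!: continuous_intros assms(1))
  qed (use assms in \<open>auto intro: continuous_intros\<close>)
  ultimately show ?thesis
    by (simp cong: continuous_on_cong)
qed

section \<open>Weighted Gram matrices\<close>

lemma transpose_gram_integrand:
  fixes L :: "real^'k^'d" and A :: "real^'d^'d"
  shows "transpose (c *\<^sub>R (transpose L ** (transpose A ** A) ** L)) =
    c *\<^sub>R (transpose L ** (transpose A ** A) ** L)"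
  by (simp add: transpose_scalar matrix_transpose_mul matrix_mul_assoc)

lemma bounded_linear_transpose: "bounded_linear (transpose :: real^'n^'m \<Rightarrow> real^'m^'n)"
  unfolding linear_conv_bounded_linear[symmetric]
  by (auto intro!: linearI simp: transpose_def vec_eq_iff)

lemma transpose_integral:
  fixes f :: "'a \<Rightarrow> real^'n^'m"
  shows "(LINT x|M. transpose (f x)) = transpose (LINT x|M. f x)"
  by (rule integral_bounded_linear'[OF bounded_linear_transpose bounded_linear_transpose]) simp

text \<open>Transposition is linear and an involution, so it preserves convergence, divergence and the
  default value \<open>0\<close> of a divergent integral. This makes the two averages of \<open>LL\<close>
  in \<open>S1\<close> transposes of each other.\<close>

lemma transpose_interval_integral:
  fixes f :: "real \<Rightarrow> real^'n^'m"
  shows "(LBINT x=a..b. transpose (f x)) = transpose (LBINT x=a..b. f x)"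
proof -
  interpret bounded_linear "transpose :: real^'n^'m \<Rightarrow> real^'m^'n"
    by (rule bounded_linear_transpose)
  show ?thesis
    unfolding interval_lebesgue_integral_def set_lebesgue_integral_def
    by (simp add: transpose_integral[symmetric] scaleR neg)
qed

lemma gram_symmetric:
  fixes L :: "'a \<Rightarrow> real^'k^'d" and A :: "'a \<Rightarrow> real^'d^'d"
  shows "transpose (LINT x|M. c x *\<^sub>R (transpose (L x) ** (transpose (A x) ** A x) ** L x)) =
    (LINT x|M. c x *\<^sub>R (transpose (L x) ** (transpose (A x) ** A x) ** L x))"
  by (simp only: transpose_integral[symmetric] transpose_gram_integrand)

lemma bounded_linear_quadratic_form:
  fixes v :: "real^'n"
  shows "bounded_linear (\<lambda>M. v \<bullet> (M *v v))"
  unfolding linear_conv_bounded_linear[symmetric]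
  by (auto intro!: linearI simp: algebra_simps inner_simps scaleR_matrix_vector_assoc[symmetric])

text \<open>The integrand of a Gram matrix, evaluated as a quadratic form, is a weighted square: the
  source of positivity.\<close>

lemma gram_integrand_form:
  fixes L :: "real^'k^'d" and A :: "real^'d^'d"
  shows "v \<bullet> ((c *\<^sub>R (transpose L ** (transpose A ** A) ** L)) *v v) = c * (norm (A *v (L *v v)))\<^sup>2"
  by (simp add: scaleR_matrix_vector_assoc[symmetric] matrix_vector_mul_assoc[symmetric]
      inner_transpose_matrix power2_norm_eq_inner del: transpose_matrix_vector)

lemma gram_form:
  fixes L :: "'a \<Rightarrow> real^'k^'d" and A :: "'a \<Rightarrow> real^'d^'d"
  assumes "integrable M (\<lambda>x. c x *\<^sub>R (transpose (L x) ** (transpose (A x) ** A x) ** L x))"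
  shows "integrable M (\<lambda>x. c x * (norm (A x *v (L x *v v)))\<^sup>2)"
    and "v \<bullet> ((LINT x|M. c x *\<^sub>R (transpose (L x) ** (transpose (A x) ** A x) ** L x)) *v v) =
      (LINT x|M. c x * (norm (A x *v (L x *v v)))\<^sup>2)"
  using integrable_bounded_linear[OF bounded_linear_quadratic_form assms, of v]
    integral_bounded_linear[OF bounded_linear_quadratic_form assms, of v]
  by (simp_all add: gram_integrand_form)

text \<open>A convergent integral inherits positivity from its integrand; a divergent one has the value
  \<open>0\<close>, which is semidefinite too.\<close>

lemma gram_nonneg:
  fixes L :: "'a \<Rightarrow> real^'k^'d" and A :: "'a \<Rightarrow> real^'d^'d"
  assumes "\<And>x. 0 \<le> c x"
  shows "0 \<le> v \<bullet> ((LINT x|M. c x *\<^sub>R (transpose (L x) ** (transpose (A x) ** A x) ** L x)) *v v)"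
proof (cases "integrable M (\<lambda>x. c x *\<^sub>R (transpose (L x) ** (transpose (A x) ** A x) ** L x))")
  case True
  then show ?thesis
    by (simp add: gram_form assms integral_nonneg)
qed (simp add: not_integrable_integral_eq)

text \<open>A continuous weight is bounded on the compact cube, so that the integrand is dominated by a
  multiple of \<open>(norm (L x))\<^sup>2\<close>.\<close>

lemma integrable_gram:
  fixes L :: "real^3 \<Rightarrow> real^'k^3"
  assumes "square_integrable_family L" and W: "continuous_on cube W"
  shows "integrable (lebesgue_on cube) (\<lambda>x. transpose (L x) ** W x ** L x)"
proof -
  have L: "L \<in> borel_measurable (lebesgue_on cube)"
    and L2: "integrable (lebesgue_on cube) (\<lambda>\<xi>. (norm (L \<xi>))\<^sup>2)"
    using assms(1) unfolding square_integrable_family_def by auto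
  have Wm: "W \<in> borel_measurable (lebesgue_on cube)"
    using W by (intro continuous_imp_measurable_on_sets_lebesgue) auto
  have "bounded (W ` cube)"
    using W by (intro compact_imp_bounded compact_continuous_image) auto
  then obtain B where B: "\<And>x. x \<in> cube \<Longrightarrow> norm (W x) \<le> B"
    by (auto simp: bounded_iff)
  \<comment> \<open>Bilinearity of the matrix product gives both measurability and norm bounds. It is needed at
    two shapes of matrices, hence stated twice.\<close>
  have bl1: "bounded_bilinear (\<lambda>(A::real^3^'k) (B::real^3^3). A ** B)"
    unfolding bilinear_conv_bounded_bilinear[symmetric] bilinear_def
    by (auto intro!: linearI simp: matrix_matrix_mult_def vec_eq_iff sum.distrib sum_distrib_left algebra_simps)
  have bl2: "bounded_bilinear (\<lambda>(A::real^3^'k) (B::real^'k^3). A ** B)"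
    unfolding bilinear_conv_bounded_bilinear[symmetric] bilinear_def
    by (auto intro!: linearI simp: matrix_matrix_mult_def vec_eq_iff sum.distrib sum_distrib_left algebra_simps)
  obtain K1 where K1: "0 \<le> K1" "\<And>(A::real^3^'k) (B::real^3^3). norm (A ** B) \<le> norm A * norm B * K1"
    using bounded_bilinear.nonneg_bounded[OF bl1] by blast
  obtain K2 where K2: "0 \<le> K2" "\<And>(A::real^3^'k) (B::real^'k^3). norm (A ** B) \<le> norm A * norm B * K2"
    using bounded_bilinear.nonneg_bounded[OF bl2] by blast
  obtain K3 where K3: "0 \<le> K3" "\<And>A::real^'k^3. norm (transpose A) \<le> norm A * K3"
    using bounded_linear.nonneg_bounded[OF bounded_linear_transpose] by blast
  have tL: "(\<lambda>x. transpose (L x)) \<in> borel_measurable (lebesgue_on cube)"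
    using L by (rule borel_measurable_continuous_on[OF
      linear_continuous_on[OF bounded_linear_transpose]])
  have meas: "(\<lambda>x. transpose (L x) ** W x ** L x) \<in> borel_measurable (lebesgue_on cube)"
    by (rule borel_measurable_bilinear[OF bl2[folded bilinear_conv_bounded_bilinear]
          borel_measurable_bilinear[OF bl1[folded bilinear_conv_bounded_bilinear] tL Wm] L]) simp_all
  show ?thesis
  proof (rule Bochner_Integration.integrable_bound[OF integrable_mult_right[OF L2, of "K3 * K1 * K2 * \<bar>B\<bar>"] meas], rule AE_I2)
    fix x assume "x \<in> space (lebesgue_on cube)"
    then have x: "norm (W x) \<le> \<bar>B\<bar>"
      using B[of x] by simp
    have "norm (transpose (L x) ** W x) \<le> norm (transpose (L x)) * norm (W x) * K1"
      by (rule K1(2))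
    also have "\<dots> \<le> (norm (L x) * K3) * \<bar>B\<bar> * K1"
      by (rule mult_right_mono[OF mult_mono[OF K3(2) x] K1(1)]) (simp_all add: K3)
    finally have LW: "norm (transpose (L x) ** W x) \<le> (norm (L x) * K3) * \<bar>B\<bar> * K1" .
    have "norm (transpose (L x) ** W x ** L x) \<le> norm (transpose (L x) ** W x) * norm (L x) * K2"
      by (rule K2(2))
    also have "\<dots> \<le> ((norm (L x) * K3) * \<bar>B\<bar> * K1) * norm (L x) * K2"
      by (rule mult_right_mono[OF mult_right_mono[OF LW] K2(1)]) simp
    finally have "norm (transpose (L x) ** W x ** L x) \<le>
      ((norm (L x) * K3) * \<bar>B\<bar> * K1) * norm (L x) * K2" .
    then show "norm (transpose (L x) ** W x ** L x) \<le> norm (K3 * K1 * K2 * \<bar>B\<bar> * (norm (L x))\<^sup>2)"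
      using K1 K2 K3 by (simp add: power2_eq_square algebra_simps)
  qed
qed

section \<open>The mass matrices\<close>

text \<open>The definition of \<open>C_k_on\<close> provides some derivative within the cube. Since the cube is a
  nondegenerate box, derivatives within it are unique up to the boundary, and this one has to be
  the Jacobian.\<close>

lemma continuous_on_DF:
  assumes "smooth_on cube F"
  shows "continuous_on cube (DF F)"
proof -
  have "C_k_on (Suc 0) cube F"
    using assms unfolding smooth_on_def by blast
  then obtain F' where F': "\<And>x. x \<in> cube \<Longrightarrow> (F has_derivative F' x) (at x within cube)"
    and cont: "\<And>v. continuous_on cube (\<lambda>x. F' x v)"
    by auto
  have "DF F x = matrix (F' x)" if "x \<in> cube" for x
    unfolding DF_def jacobian_def
    by (subst frechet_derivative_within_cbox[OF _ that F'[OF that]])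
      (auto simp: Basis_vec_def inner_axis)
  moreover have "continuous_on cube (\<lambda>x. matrix (F' x))"
    unfolding matrix_def by (intro continuous_on_vec_lambda continuous_on_component cont)
  ultimately show ?thesis
    by (simp cong: continuous_on_cong)
qed

lemma transpose_mass1: "transpose (mass1 F \<Lambda>) = mass1 F \<Lambda>"
  unfolding mass1_def G\<^sub>n_def by (rule gram_symmetric)

lemma transpose_mass2: "transpose (mass2 F \<Lambda>) = mass2 F \<Lambda>"
  unfolding mass2_def G\<^sub>t_def by (rule gram_symmetric)

lemma mass2_nonneg: "0 \<le> v \<bullet> (mass2 F \<Lambda> *v v)"
  unfolding mass2_def G\<^sub>t_def by (rule gram_nonneg) simp

text \<open>The form \<open>v \<bullet> M\<^sub>1 v\<close> is the integral of \<open>\<bar>J\<bar> \<bar>N \<Lambda> v\<bar>\<^sup>2\<close>. If it vanishes, then so does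
  \<open>\<Lambda> v\<close> almost everywhere, because \<open>J\<close> is nonzero and \<open>N\<close> is invertible, and
  independence of the family yields \<open>v = 0\<close>.\<close>

lemma mass1_pos:
  assumes smooth: "smooth_on cube F" and J: "\<And>\<xi>. \<xi> \<in> cube \<Longrightarrow> J F \<xi> \<noteq> 0"
    and indep: "independent_family \<Lambda>" and sq: "square_integrable_family \<Lambda>"
    and "v \<noteq> 0"
  shows "0 < v \<bullet> (mass1 F \<Lambda> *v v)"
proof -
  let ?c = "\<lambda>x. \<bar>J F x\<bar> * (norm (N F x *v (\<Lambda> x *v v)))\<^sup>2"
  have cD: "continuous_on cube (DF F)"
    by (rule continuous_on_DF[OF smooth])
  have cN: "continuous_on cube (N F)"
    unfolding N_def using J
    by (intro bounded_linear.continuous_on[OF bounded_linear_transpose] continuous_on_matrix_inv cD)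
      (simp add: J_def)
  have cW: "continuous_on cube (\<lambda>x. \<bar>J F x\<bar> *\<^sub>R G\<^sub>n F x)"
    unfolding J_def det_def G\<^sub>n_def matrix_matrix_mult_def transpose_def
    by (intro continuous_intros continuous_on_vec_lambda cN cD) 
  have "integrable (lebesgue_on cube) (\<lambda>x. transpose (\<Lambda> x) ** (\<bar>J F x\<bar> *\<^sub>R G\<^sub>n F x) ** \<Lambda> x)"
    by (rule integrable_gram[OF sq cW])
  also have "(\<lambda>x. transpose (\<Lambda> x) ** (\<bar>J F x\<bar> *\<^sub>R G\<^sub>n F x) ** \<Lambda> x) =
      (\<lambda>x. \<bar>J F x\<bar> *\<^sub>R (transpose (\<Lambda> x) ** (transpose (N F x) ** N F x) ** \<Lambda> x))"
    by (simp add: G\<^sub>n_def matrix_scalar_ac scalar_matrix_assoc[symmetric])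
  finally have int: "integrable (lebesgue_on cube) \<dots>" .
  have eq: "v \<bullet> (mass1 F \<Lambda> *v v) = (LINT x|lebesgue_on cube. ?c x)"
    unfolding mass1_def G\<^sub>n_def by (rule gram_form(2)[OF int])
  have "(LINT x|lebesgue_on cube. ?c x) \<noteq> 0"
  proof
    assume "(LINT x|lebesgue_on cube. ?c x) = 0"
    then have c0: "AE x in lebesgue_on cube. ?c x = 0"
      using gram_form(1)[OF int, of v] by (subst (asm) integral_nonneg_eq_0_iff_AE) auto
    have nz: "\<Lambda> x *v v = 0" if "x \<in> cube" "?c x = 0" for x
    proof -
      have "det (N F x) \<noteq> 0"
        using J[OF that(1)] matrix_inv_right_of_trivial_kernel[of "DF F x"]
        unfolding J_def N_def det_transpose
        by (metis det_I det_mul invertible_det_nz invertible_left_inverse matrix_left_invertible_ker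
            mult_zero_right zero_neq_one)
      then show ?thesis
        using that J by (metis invertible_det_nz invertible_left_inverse matrix_left_invertible_ker
            abs_eq_0 mult_eq_0_iff norm_eq_zero power_eq_0_iff)
    qed
    have "AE x in lebesgue_on cube. \<Lambda> x *v v = 0"
      using c0 AE_space[of "lebesgue_on cube"]
      by eventually_elim (rule nz, simp_all only: space_lebesgue_on)
    with indep \<open>v \<noteq> 0\<close> show False
      unfolding independent_family_def by blast
  qed
  moreover have "0 \<le> (LINT x|lebesgue_on cube. ?c x)"
    by (rule Bochner_Integration.integral_nonneg) simp
  ultimately show ?thesis
    unfolding eq by linarith
qed

section \<open>Particle matrices\<close>

lemma particle_kronecker_diag:
  "particle (kronecker (diag d) (mat 1) *v V) p = d p *\<^sub>R particle V p"
proof -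
  have "(\<Sum>j\<in>UNIV. diag d $ p $ fst j * mat 1 $ i $ snd j * V $ j) =
      (\<Sum>j\<in>UNIV. if j = (p, i) then d p * V $ j else 0)" for i
    by (rule sum.cong) (auto simp: prod_eq_iff diag_def mat_def)
  then show ?thesis
    by (simp add: particle_def kronecker_def matrix_vector_mult_def vec_eq_iff)
qed

lemma sum_over_particles: "(\<Sum>j\<in>UNIV. f j) = (\<Sum>p\<in>UNIV. \<Sum>i\<in>UNIV. f (p, i))"
  unfolding UNIV_Times_UNIV[symmetric] sum.cartesian_product by simp

lemma particle_block_diag: "particle (block_diag A *v V) p = A p *v particle V p"
proof -
  have "(\<Sum>p'\<in>UNIV. \<Sum>j\<in>UNIV. (if p = p' then A (fst (p, i)) $ snd (p, i) $ snd (p', j) else 0) * V $ (p', j)) =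
      (\<Sum>p'\<in>UNIV. if p' = p then \<Sum>j\<in>UNIV. A p $ i $ j * V $ (p, j) else 0)" for i
    by (rule sum.cong) auto
  then show ?thesis
    by (simp add: particle_def block_diag_def matrix_vector_mult_def vec_eq_iff sum_over_particles)
qed

lemma inner_particles: "V \<bullet> W = (\<Sum>p\<in>UNIV. particle V p \<bullet> particle W p)"
  by (simp add: inner_vec_def particle_def sum_over_particles)

lemma transpose_block_diag: "transpose (block_diag A) = block_diag (\<lambda>p. transpose (A p))"
  by (simp add: transpose_def block_diag_def vec_eq_iff)

lemma transpose_kronecker_diag:
  "transpose (kronecker (diag d) (mat 1)) = kronecker (diag d) (mat 1 :: real^'n^'n)"
  by (auto simp: transpose_def kronecker_def diag_def mat_def vec_eq_iff)

lemma MM\<^sub>m_right_inverse: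
  fixes \<omega> m :: "'p::finite \<Rightarrow> real"
  assumes "\<And>p. \<omega> p > 0" and "\<And>p. m p > 0"
  shows "MM\<^sub>m \<omega> m ** matrix_inv (MM\<^sub>m \<omega> m) = mat 1"
proof (rule matrix_inv_right_of_trivial_kernel)
  fix V :: "real^('p\<times>3)"
  assume "MM\<^sub>m \<omega> m *v V = 0"
  then have "particle (MM\<^sub>m \<omega> m *v V) p = 0" for p
    by (simp add: particle_def vec_eq_iff)
  then have "particle V p = 0" for p
    using assms(1)[of p] assms(2)[of p]
    by (simp add: MM\<^sub>m_def particle_kronecker_diag) (metis less_irrefl)
  then show "V = 0"
    by (simp add: particle_def vec_eq_iff)
qed

text \<open>Particle by particle, \<open>V\<^sub>p \<bullet> N (N\<^sup>T V\<^sub>p \<times> B) = (N\<^sup>T V\<^sub>p) \<bullet> (N\<^sup>T V\<^sub>p \<times> B) = 0\<close>, and the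
  charge matrix only rescales this by \<open>\<omega>\<^sub>p q\<^sub>p\<close>.\<close>

lemma magnetic_force_orthogonal:
  "V \<bullet> ((MM\<^sub>q \<omega> q ** NN F X ** BB \<Lambda> X b ** transpose (NN F X)) *v V) = 0"
proof -
  have "particle V p \<bullet> particle ((MM\<^sub>q \<omega> q ** NN F X ** BB \<Lambda> X b ** transpose (NN F X)) *v V) p = 0"
    for p
  proof -
    let ?N = "N F (particle X p)" and ?B = "\<Lambda> (particle X p) *v b"
    have "bilinear cross3"
      using bilinear_cross by blast
    then have lin: "linear (\<lambda>w. cross3 w ?B)"
      unfolding bilinear_def by blast
    have "particle V p \<bullet> (?N *v (cross3 (transpose ?N *v particle V p) ?B)) =
        (transpose ?N *v particle V p) \<bullet> cross3 (transpose ?N *v particle V p) ?B"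
      by (metis inner_transpose_matrix transpose_transpose)
    then have "particle V p \<bullet> (?N *v (cross3 (transpose ?N *v particle V p) ?B)) = 0"
      by (simp add: dot_cross_self)
    then show ?thesis
      unfolding MM\<^sub>q_def NN_def BB_def transpose_block_diag
      by (simp add: matrix_vector_mul_assoc[symmetric] particle_kronecker_diag particle_block_diag
          matrix_works lin del: transpose_matrix_vector)
  qed
  then show ?thesis
    by (simp add: inner_particles)
qed

section \<open>Energy conservation in each substep\<close>

text \<open>Work done on the particles by the field equals the energy that the field loses: the
  coupling matrix in the equation for \<open>e\<close> is minus the transpose of that in the equation for
  \<open>V\<close>.\<close>

lemma S1_conserves_energy:
  assumes M: "\<And>p. \<omega> p > 0" "\<And>p. m p > 0" and h: "h \<noteq> 0"
    and S1: "S1 F \<Lambda>1 \<omega> m q t h (X, V, e, b) (X', V', e', b')"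
  shows "energy F \<Lambda>1 \<Lambda>2 \<omega> m (X', V', e', b') = energy F \<Lambda>1 \<Lambda>2 \<omega> m (X, V, e, b)"
proof -
  define I where "I = (LBINT \<tau>=ereal t..ereal (t + h). LL \<Lambda>1 (line_path t h X X' \<tau>))"
  define H where "H = (1/2) *\<^sub>R (NN F X + NN F X')"
  define P where "P = MM\<^sub>q \<omega> q ** H ** I"
  have tH: "transpose H = (1/2) *\<^sub>R (transpose (NN F X) + transpose (NN F X'))"
    unfolding H_def by (simp add: transpose_def vec_eq_iff)
  have tP: "transpose P = transpose I ** transpose H ** MM\<^sub>q \<omega> q"
    unfolding P_def MM\<^sub>q_def by (simp add: matrix_transpose_mul transpose_kronecker_diag matrix_mul_assoc)
  have 1: "(1 / h) *\<^sub>R (V' - V) = (matrix_inv (MM\<^sub>m \<omega> m) ** MM\<^sub>q \<omega> q ** H ** ((1 / h) *\<^sub>R I)) *v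
      ((1/2) *\<^sub>R (e' + e))"
    and 2: "(1 / h) *\<^sub>R (mass1 F \<Lambda>1 *v e' - mass1 F \<Lambda>1 *v e) =
      - ((((1 / h) *\<^sub>R transpose I) ** transpose H ** MM\<^sub>q \<omega> q) *v ((1/2) *\<^sub>R (V' + V)))"
    and b': "b' = b"
    using S1 by (simp_all add: I_def H_def tH[unfolded H_def] transpose_interval_integral
        del: transpose_matrix_vector)
  have "(1 / h) *\<^sub>R (V' - V) = (1 / h) *\<^sub>R (1/2) *\<^sub>R (matrix_inv (MM\<^sub>m \<omega> m) *v (P *v (e' + e)))"
    unfolding 1 P_def
    by (simp only: matrix_vector_mul_assoc[symmetric] scaleR_matrix_vector_assoc[symmetric]
        matrix_vector_mult_scaleR scaleR_scaleR mult.commute)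
  then have "V' - V = (1/2) *\<^sub>R (matrix_inv (MM\<^sub>m \<omega> m) *v (P *v (e' + e)))"
    using h by (subst (asm) scaleR_cancel_left) simp
  then have Vd: "MM\<^sub>m \<omega> m *v (V' - V) = (1/2) *\<^sub>R (P *v (e' + e))"
    by (simp add: matrix_vector_mult_scaleR matrix_vector_mul_assoc matrix_mul_assoc
        MM\<^sub>m_right_inverse[OF M])
  have "(1 / h) *\<^sub>R (mass1 F \<Lambda>1 *v (e' - e)) = (1 / h) *\<^sub>R (- (1/2)) *\<^sub>R (transpose P *v (V' + V))"
    unfolding matrix_vector_mult_diff_distrib 2 tP
    by (simp add: matrix_vector_mul_assoc[symmetric] scaleR_matrix_vector_assoc[symmetric]
        matrix_vector_mult_scaleR del: transpose_matrix_vector)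
  then have ed: "mass1 F \<Lambda>1 *v (e' - e) = (- (1/2)) *\<^sub>R (transpose P *v (V' + V))"
    using h by (subst (asm) scaleR_cancel_left) simp
  have "V' \<bullet> (MM\<^sub>m \<omega> m *v V') - V \<bullet> (MM\<^sub>m \<omega> m *v V) = (1/2) * ((V' + V) \<bullet> (P *v (e' + e)))"
    using symmetric_form_difference[of "MM\<^sub>m \<omega> m" V' V] Vd
    by (simp add: MM\<^sub>m_def transpose_kronecker_diag)
  moreover have "e' \<bullet> (mass1 F \<Lambda>1 *v e') - e \<bullet> (mass1 F \<Lambda>1 *v e) =
      - (1/2) * ((e' + e) \<bullet> (transpose P *v (V' + V)))"
    using symmetric_form_difference[OF transpose_mass1, of e' F \<Lambda>1 e] ed by simp
  moreover have "(e' + e) \<bullet> (transpose P *v (V' + V)) = (V' + V) \<bullet> (P *v (e' + e))"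
    by (metis inner_transpose_matrix inner_commute)
  ultimately show ?thesis
    by (simp add: b')
qed

lemma S2_conserves_energy:
  assumes M: "\<And>p. \<omega> p > 0" "\<And>p. m p > 0"
    and S2: "S2 F \<Lambda>2 \<omega> m q h (X, V, e, b) (X', V', e', b')"
  shows "energy F \<Lambda>1 \<Lambda>2 \<omega> m (X', V', e', b') = energy F \<Lambda>1 \<Lambda>2 \<omega> m (X, V, e, b)"
proof -
  define R where "R = MM\<^sub>q \<omega> q ** NN F X ** BB \<Lambda>2 X b ** transpose (NN F X)"
  define K where "K = matrix_inv (MM\<^sub>m \<omega> m) ** R"
  have "(mat 1 - (h/2) *\<^sub>R K) *v V' = (mat 1 + (h/2) *\<^sub>R K) *v V"
    and same: "e' = e" "b' = b"
    using S2 by (simp_all add: K_def R_def Let_def matrix_mul_assoc)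
  then have "V' - V = (h/2) *\<^sub>R (K *v (V' + V))"
    by (simp add: algebra_simps scaleR_matrix_vector_assoc[symmetric])
  then have "MM\<^sub>m \<omega> m *v (V' - V) = (h/2) *\<^sub>R (R *v (V' + V))"
    by (simp add: K_def matrix_vector_mult_scaleR matrix_vector_mul_assoc matrix_mul_assoc
        MM\<^sub>m_right_inverse[OF M])
  moreover have "(V' + V) \<bullet> (R *v (V' + V)) = 0"
    unfolding R_def by (rule magnetic_force_orthogonal)
  ultimately have "V' \<bullet> (MM\<^sub>m \<omega> m *v V') = V \<bullet> (MM\<^sub>m \<omega> m *v V)"
    using symmetric_form_difference[of "MM\<^sub>m \<omega> m" V' V]
    by (simp add: MM\<^sub>m_def transpose_kronecker_diag)
  with same show ?thesis by simp
qed

text \<open>Multiplying the formula for \<open>e'\<close> by \<open>S\<close> and substituting the formula for \<open>b'\<close> recovers the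
  midpoint rule \<open>M\<^sub>1 (e' - e) = h/2 C\<^sup>T M\<^sub>2 (b' + b)\<close>, \<open>b' - b = - h/2 C (e' + e)\<close>. Definiteness
  of \<open>M\<^sub>1\<close> makes \<open>S\<close> invertible.\<close>

lemma S3_conserves_energy:
  assumes pos: "\<And>v. v \<noteq> 0 \<Longrightarrow> 0 < v \<bullet> (mass1 F \<Lambda>1 *v v)"
    and S3: "S3 F \<Lambda>1 \<Lambda>2 C h (X, V, e, b) (X', V', e', b')"
  shows "energy F \<Lambda>1 \<Lambda>2 \<omega> m (X', V', e', b') = energy F \<Lambda>1 \<Lambda>2 \<omega> m (X, V, e, b)"
proof -
  define M\<^sub>1 where "M\<^sub>1 = mass1 F \<Lambda>1"
  define M\<^sub>2 where "M\<^sub>2 = mass2 F \<Lambda>2"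
  define Q where "Q = (h\<^sup>2/4) *\<^sub>R (transpose C ** M\<^sub>2 ** C)"
  define S where "S = M\<^sub>1 + Q"
  have e': "e' = matrix_inv S *v ((M\<^sub>1 - Q) *v e + h *\<^sub>R ((transpose C ** M\<^sub>2) *v b))"
    and bd: "b' = b - (h/2) *\<^sub>R (C *v (e + e'))" and V': "V' = V"
    using S3 by (simp_all add: M\<^sub>1_def M\<^sub>2_def Q_def S_def Let_def)
  have Qv: "Q *v v = (h\<^sup>2/4) *\<^sub>R (transpose C *v (M\<^sub>2 *v (C *v v)))" for v
    by (simp add: Q_def scaleR_matrix_vector_assoc[symmetric] matrix_vector_mul_assoc[symmetric]
        del: transpose_matrix_vector)
  have "S ** matrix_inv S = mat 1"
  proof (rule matrix_inv_right_of_trivial_kernel, rule ccontr)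
    fix v assume v: "S *v v = 0" "v \<noteq> 0"
    have "v \<bullet> (S *v v) = v \<bullet> (M\<^sub>1 *v v) + (h\<^sup>2/4) * ((C *v v) \<bullet> (M\<^sub>2 *v (C *v v)))"
      by (simp add: S_def matrix_vector_mult_add_rdistrib inner_simps Qv inner_transpose_matrix
          del: transpose_matrix_vector)
    also have "\<dots> > 0"
      using pos[OF v(2)] mass2_nonneg[of "C *v v" F \<Lambda>2]
      by (simp add: M\<^sub>1_def M\<^sub>2_def add_pos_nonneg)
    finally show False using v by simp
  qed
  then have "S *v e' = (M\<^sub>1 - Q) *v e + h *\<^sub>R (transpose C *v (M\<^sub>2 *v b))"
    by (simp add: e' matrix_vector_mul_assoc del: transpose_matrix_vector)
  then have "M\<^sub>1 *v (e' - e) = h *\<^sub>R (transpose C *v (M\<^sub>2 *v b)) - Q *v (e + e')"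
    by (simp add: S_def algebra_simps del: transpose_matrix_vector)
  \<comment> \<open>The term with \<open>Q\<close> is exactly what replaces \<open>2 b\<close> by \<open>b + b'\<close>.\<close>
  also have "\<dots> = (h/2) *\<^sub>R (transpose C *v (M\<^sub>2 *v (b' + b)))"
    unfolding Qv bd
    by (simp add: algebra_simps power2_eq_square scaleR_2[symmetric] del: transpose_matrix_vector)
  finally have ed: "M\<^sub>1 *v (e' - e) = (h/2) *\<^sub>R (transpose C *v (M\<^sub>2 *v (b' + b)))" .
  have "e' \<bullet> (M\<^sub>1 *v e') - e \<bullet> (M\<^sub>1 *v e) = (h/2) * ((C *v (e' + e)) \<bullet> (M\<^sub>2 *v (b' + b)))"
    using symmetric_form_difference[OF transpose_mass1, of e' F \<Lambda>1 e] ed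
    by (simp add: M\<^sub>1_def inner_transpose_matrix del: transpose_matrix_vector)
  moreover have "b' \<bullet> (M\<^sub>2 *v b') - b \<bullet> (M\<^sub>2 *v b) = - ((h/2) * ((C *v (e' + e)) \<bullet> (M\<^sub>2 *v (b' + b))))"
  proof -
    have "b' \<bullet> (M\<^sub>2 *v b') - b \<bullet> (M\<^sub>2 *v b) = (M\<^sub>2 *v (b' + b)) \<bullet> (b' - b)"
      using symmetric_form_difference[OF transpose_mass2, of b' F \<Lambda>2 b]
        inner_transpose_matrix[of "b' + b" M\<^sub>2 "b' - b"]
      by (simp add: M\<^sub>2_def transpose_mass2 del: transpose_matrix_vector)
    also have "b' - b = - ((h/2) *\<^sub>R (C *v (e' + e)))"
      by (simp add: bd add.commute)
    finally show ?thesis by (simp add: inner_commute)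
  qed
  ultimately show ?thesis
    by (simp add: V' M\<^sub>1_def M\<^sub>2_def)
qed

section \<open>Energy conservation along the splitting scheme\<close>

theorem proposition5p3:
  fixes F :: "real^3 \<Rightarrow> real^3" and \<Omega> :: "(real^3) set"
    and \<Lambda>0 :: "real^3 \<Rightarrow> real^'n0^1" and \<Lambda>1 :: "real^3 \<Rightarrow> real^('n1::finite\<times>3)^3"
    and \<Lambda>2 :: "real^3 \<Rightarrow> real^('n2::finite\<times>3)^3" and \<Lambda>3 :: "real^3 \<Rightarrow> real^'n3^1"
    and G :: "real^'n0^('n1\<times>3)" and C :: "real^('n1\<times>3)^('n2\<times>3)" and D :: "real^('n2\<times>3)^'n3"
    and \<omega> m q :: "'p::finite \<Rightarrow> real"
    and X :: "real^('p\<times>3)" and V :: "real^('p\<times>3)"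
    and e :: "real^('n1\<times>3)" and b :: "real^('n2\<times>3)"
    and s' :: "('p, 'n1, 'n2) state"
  assumes "smooth_on cube F" and "bij_betw F cube \<Omega>" and "\<And>\<xi>. \<xi> \<in> cube \<Longrightarrow> J F \<xi> \<noteq> 0"
    and "independent_family \<Lambda>0" and "independent_family \<Lambda>1"
    and "independent_family \<Lambda>2" and "independent_family \<Lambda>3"
    and "square_integrable_family \<Lambda>1" and "square_integrable_family \<Lambda>2"
    and "discrete_de_rham \<Lambda>0 \<Lambda>1 \<Lambda>2 \<Lambda>3 G C D"
    and "\<And>p. \<omega> p > 0" and "\<And>p. m p > 0"
    and "\<And>p. particle X p \<in> cube"
    and "(substep F \<Lambda>1 \<Lambda>2 C \<omega> m q)\<^sup>*\<^sup>* (X, V, e, b) s'"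
  shows "energy F \<Lambda>1 \<Lambda>2 \<omega> m s' = energy F \<Lambda>1 \<Lambda>2 \<omega> m (X, V, e, b)"
  using assms(14)
proof (induction rule: rtranclp_induct)
  case base
  show ?case ..
next
  case (step s s')
  obtain X V e b where s: "s = (X, V, e, b)" by (cases s)
  obtain X' V' e' b' where s': "s' = (X', V', e', b')" by (cases s')
  have pos: "0 < v \<bullet> (mass1 F \<Lambda>1 *v v)" if "v \<noteq> 0" for v
    by (rule mass1_pos[OF assms(1,3,5,8) that])
  have "energy F \<Lambda>1 \<Lambda>2 \<omega> m s' = energy F \<Lambda>1 \<Lambda>2 \<omega> m s"
    using step(2) pos unfolding substep_def s s'
    by (elim exE conjE disjE)
      (rule S1_conserves_energy S2_conserves_energy S3_conserves_energy; (rule assms | assumption))+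
  with step.IH show ?case by simp
qed

end
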